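(* Let $m$ be a flow measure on a tree $T$ rooted at infinity with vertex set $V$. Then $m$ does not satisfy the isoperimetric inequality on $T$; that is, there is no constant $C_{iso}>0$ such that $m(\partial A)\ge C_{iso}\,m(A)$ for every bounded $A\subset V$.
   Context: Tree with root at infinity: $T=(V,E)$ is an (undirected) tree with geodesic distance $d$, $o\in V$ is a fixed origin, and a half-infinite geodesic starting at $o$ is fixed, identified with a boundary point, the root. For $x\in V$ let $\Pi(x)$ be the vertex of this geodesic closest to $x$; the level of $x$ is $\ell(x)=d(o,\Pi(x))-d(\Pi(x),x)$. The set of sons of $x$ is $s(x)=\{y\sim x:\ \ell(y)=\ell(x)-1\}$. Flow measure: a function $m:V\to(0,\infty)$ (strictly positive) with $m(x)=\sum_{y\in s(x)}m(y)$ for all $x\in V$; also regarded as the measure $m(A)=\sum_{x\in A}m(x)$. Boundary of a set of vertices: $\partial A=\{x\in A:\ \exists\, y\in A^c\text{ with }y\sim x\}$. Bounded means bounded with respect to $d$. *)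

theory Defs
  imports "HOL-Analysis.Analysis"
begin

text \<open>Undirected simple graphs, with edges as two-element sets of vertices. Neither the vertex set
  nor the vertex degrees are required to be finite.\<close>

locale ugraph =
  fixes V :: "'v set" and E :: "'v set set"
  assumes edges: "e \<in> E \<Longrightarrow> e \<subseteq> V \<and> card e = 2"
begin

definition adj :: "'v \<Rightarrow> 'v \<Rightarrow> bool" where
  "adj x y \<longleftrightarrow> {x, y} \<in> E"

definition walk :: "'v list \<Rightarrow> bool" where
  "walk xs \<longleftrightarrow> xs \<noteq> [] \<and> set xs \<subseteq> V \<and> successively adj xs"

definition walk_between :: "'v \<Rightarrow> 'v list \<Rightarrow> 'v \<Rightarrow> bool" where
  "walk_between x xs y \<longleftrightarrow> walk xs \<and> hd xs = x \<and> last xs = y"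

text \<open>A cycle is given by its distinct vertices; the first one is not repeated at the end.\<close>

definition cycle :: "'v list \<Rightarrow> bool" where
  "cycle xs \<longleftrightarrow> walk xs \<and> distinct xs \<and> 3 \<le> length xs \<and> adj (last xs) (hd xs)"

definition gdist :: "'v \<Rightarrow> 'v \<Rightarrow> nat" where
  "gdist x y = (LEAST n. \<exists>xs. walk_between x xs y \<and> length xs = Suc n)"

definition gbounded :: "'v set \<Rightarrow> bool" where
  "gbounded A \<longleftrightarrow> (\<exists>r. \<forall>x\<in>A. \<forall>y\<in>A. gdist x y \<le> r)"

definition boundary :: "'v set \<Rightarrow> 'v set" where
  "boundary A = {x \<in> A. \<exists>y \<in> V - A. adj x y}"

text \<open>The measure with density \<open>m\<close>, with values in \<open>[0, \<infinity>]\<close>, as bounded sets may be infinite.\<close>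

definition mass :: "('v \<Rightarrow> real) \<Rightarrow> 'v set \<Rightarrow> ennreal" where
  "mass m A = (\<Sum>\<^sub>\<infinity>x\<in>A. ennreal (m x))"

definition isoperimetric :: "('v \<Rightarrow> real) \<Rightarrow> bool" where
  "isoperimetric m \<longleftrightarrow>
     (\<exists>C::real. C > 0 \<and>
       (\<forall>A. A \<subseteq> V \<and> gbounded A \<longrightarrow> mass m (boundary A) \<ge> ennreal C * mass m A))"

end

locale utree = ugraph +
  assumes connected: "\<lbrakk>x \<in> V; y \<in> V\<rbrakk> \<Longrightarrow> \<exists>xs. walk_between x xs y"
    and acyclic: "\<not> cycle xs"

text \<open>The root at infinity is the end of the tree represented by the geodesic ray \<open>\<gamma>\<close>.\<close>

locale tree_rooted_at_infinity = utree V E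
  for V :: "'v set" and E :: "'v set set" +
  fixes orig :: 'v and \<gamma> :: "nat \<Rightarrow> 'v"
  assumes ray_start: "\<gamma> 0 = orig"
    and ray_in_V: "\<gamma> i \<in> V"
    and ray_geodesic: "i \<le> j \<Longrightarrow> gdist (\<gamma> i) (\<gamma> j) = j - i"
begin

definition proj :: "'v \<Rightarrow> 'v" where
  "proj x = (THE p. is_arg_min (\<lambda>q. gdist q x) (\<lambda>q. q \<in> range \<gamma>) p)"

definition level :: "'v \<Rightarrow> int" where
  "level x = int (gdist orig (proj x)) - int (gdist (proj x) x)"

definition sons :: "'v \<Rightarrow> 'v set" where
  "sons x = {y \<in> V. adj x y \<and> level y = level x - 1}"

text \<open>A vertex may have infinitely many sons, so the flow condition is a possibly infinite,
  convergent sum (which is the finite sum when there are finitely many sons).\<close>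

definition flow_measure :: "('v \<Rightarrow> real) \<Rightarrow> bool" where
  "flow_measure m \<longleftrightarrow> (\<forall>x\<in>V. m x > 0 \<and> (m has_sum m x) (sons x))"

end

end

theory Submission
  imports Defs
begin

text \<open>Write \<open>D\<^sub>k\<close> for the set of descendants of the origin in generation \<open>k\<close>, and let
  \<open>A = D\<^sub>0 \<union> \<dots> \<union> D\<^sub>n\<close>. Every vertex has a unique neighbour that is not one of its sons, so
  the \<open>D\<^sub>k\<close> are disjoint unions of sets of sons, and the flow condition gives all of them
  the mass \<open>m(o)\<close>. Hence \<open>m(A) = (n + 1) m(o)\<close>, while \<open>\<partial>A \<subseteq> D\<^sub>0 \<union> D\<^sub>n\<close> has mass at most
  \<open>2 m(o)\<close>. Uniqueness of the father is seen from far out on the ray, where the level becomes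
  a Busemann function: \<open>d(\<gamma>\<^sub>n, x) = n - level x\<close> for all large \<open>n\<close>.\<close>

section \<open>Distances and masses in graphs and trees\<close>

context ugraph
begin

lemma adj_sym: "adj x y \<longleftrightarrow> adj y x"
  by (simp add: adj_def insert_commute)

lemma adj_in_V: assumes "adj x y" shows "x \<in> V" "y \<in> V"
  using edges assms by (auto simp: adj_def)

lemma adj_neq: "adj x y \<Longrightarrow> x \<noteq> y"
  using edges[of "{x, y}"] by (auto simp: adj_def)

lemma gdist_le:
  assumes "walk_between x xs y" "length xs \<le> Suc n"
  shows "gdist x y \<le> n"
proof -
  have "xs \<noteq> []"
    using assms by (auto simp: walk_between_def walk_def)
  then obtain k where k: "length xs = Suc k"
    by (cases xs) auto
  then have "gdist x y \<le> k"
    unfolding gdist_def using assms by (intro Least_le) blast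
  then show ?thesis
    using k assms by simp
qed

lemma gdist_self: "x \<in> V \<Longrightarrow> gdist x x = 0"
  using gdist_le[of x "[x]" x 0] by (simp add: walk_between_def walk_def)

lemma walk_between_rev: "walk_between x xs y \<Longrightarrow> walk_between y (rev xs) x"
  by (auto simp: walk_between_def walk_def hd_rev last_rev adj_sym)

lemma gdist_commute: "gdist x y = gdist y x"
proof -
  have "(\<exists>xs. walk_between x xs y \<and> length xs = n) \<longleftrightarrow> (\<exists>xs. walk_between y xs x \<and> length xs = n)"
    for n
    using walk_between_rev by (metis length_rev)
  then show ?thesis
    unfolding gdist_def by simp
qed

text \<open>\<open>ennreal\<close> is additive on nonnegative reals and continuous, so it commutes
  with unordered sums. This carries the real-valued flow condition over to
  \<open>mass\<close>.\<close>

lemma mass_has_sum: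
  assumes "(m has_sum s) A" "\<And>x. x \<in> A \<Longrightarrow> 0 \<le> m x"
  shows "mass m A = ennreal s"
proof -
  have "(ennreal \<circ> m has_sum ennreal s) A"
  proof (rule has_sum_comm_additive_general[OF _ _ assms(1)])
    show "sum (ennreal \<circ> m) F = ennreal (sum m F)" if "finite F" "F \<subseteq> A" for F
      using that assms(2) by (subst sum_ennreal[symmetric]) auto
    show "ennreal \<midarrow>s\<rightarrow> ennreal s"
      by (intro tendsto_ennrealI tendsto_ident_at)
  qed
  then show ?thesis
    unfolding mass_def by (auto dest: infsumI simp: o_def)
qed

lemma mass_mono: "A \<subseteq> B \<Longrightarrow> mass m A \<le> mass m B"
  unfolding mass_def by (intro infsum_mono_neutral nonneg_summable_on_complete) auto

lemma mass_Un_le: "mass m (A \<union> B) \<le> mass m A + mass m B"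
proof -
  have "mass m (A \<union> (B - A)) = mass m A + mass m (B - A)"
    unfolding mass_def by (intro infsum_Un_disjoint nonneg_summable_on_complete) auto
  also have "\<dots> \<le> mass m A + mass m B"
    by (intro add_left_mono mass_mono) auto
  finally show ?thesis
    by simp
qed

end

section \<open>Geodesics and cycles in a tree\<close>

context utree
begin

lemma shortest_walk:
  assumes "x \<in> V" "y \<in> V"
  obtains xs where "walk_between x xs y" "length xs = Suc (gdist x y)"
proof -
  obtain ys where ys: "walk_between x ys y"
    using connected assms by blast
  then have "length ys = Suc (length ys - 1)"
    by (cases ys) (auto simp: walk_between_def walk_def)
  with ys have "\<exists>n xs. walk_between x xs y \<and> length xs = Suc n"
    by blast
  then have "\<exists>xs. walk_between x xs y \<and> length xs = Suc (gdist x y)"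
    unfolding gdist_def by (rule LeastI_ex)
  then show ?thesis
    using that by blast
qed

lemma gdist_adj_le:
  assumes "z \<in> V" "adj x y"
  shows "gdist z y \<le> Suc (gdist z x)"
proof -
  obtain xs where xs: "walk_between z xs x" "length xs = Suc (gdist z x)"
    using shortest_walk assms adj_in_V by metis
  then have "walk_between z (xs @ [y]) y"
    using assms adj_in_V[OF assms(2)]
    by (auto simp: walk_between_def walk_def successively_append_iff)
  then show ?thesis
    using xs by (auto intro: gdist_le)
qed

text \<open>Take the last vertex but one of a shortest walk: the shortened walk bounds its distance
  from above, and adjacency to \<open>x\<close> bounds it from below.\<close>

lemma gdist_predecessor:
  assumes "z \<in> V" "x \<in> V" "gdist z x = Suc n"
  obtains y where "adj y x" "gdist z y = n"
proof -
  obtain xs where xs: "walk_between z xs x" "length xs = Suc (Suc n)"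
    using shortest_walk assms by metis
  then obtain ys where ys: "xs = ys @ [x]" "length ys = Suc n"
    by (cases xs rule: rev_cases) (auto simp: walk_between_def)
  then have "ys \<noteq> []"
    by auto
  then have "walk_between z ys (last ys)" and adj: "adj (last ys) x"
    using xs(1) unfolding ys(1) walk_between_def walk_def
    by (simp_all add: successively_append_iff)
  then have "gdist z (last ys) \<le> n"
    using ys by (auto intro: gdist_le)
  moreover have "Suc n \<le> Suc (gdist z (last ys))"
    using gdist_adj_le[OF assms(1) adj] assms by simp
  ultimately show ?thesis
    using that adj by simp
qed

lemma gdist_1_adj:
  assumes "x \<in> V" "y \<in> V" "gdist x y = 1"
  shows "adj x y"
proof -
  obtain w where w: "adj w y" "gdist x w = 0"
    using gdist_predecessor[of x y 0] assms by auto
  obtain xs where "walk_between x xs w" "length xs = Suc 0"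
    using shortest_walk[of x w] assms w adj_in_V by metis
  then have "x = w"
    by (auto simp: walk_between_def length_Suc_conv)
  then show ?thesis
    using w by simp
qed

text \<open>Two geodesics towards \<open>z\<close>, followed up to where they meet, give the path below; an edge between
  its ends, or a common neighbour of them outside the ball, would close it to a cycle.\<close>

lemma path_in_ball:
  assumes "z \<in> V" "u \<in> V" "v \<in> V" "u \<noteq> v" "gdist z u = n" "gdist z v = n"
  shows "\<exists>xs. walk_between u xs v \<and> distinct xs \<and> 3 \<le> length xs \<and> (\<forall>w\<in>set xs. gdist z w \<le> n)"
  using assms(2-)
proof (induction n arbitrary: u v)
  case 0
  have "w = z" if "w \<in> V" "gdist z w = 0" for w
  proof -
    obtain xs where "walk_between z xs w" "length xs = Suc 0"
      using shortest_walk[of z w] \<open>z \<in> V\<close> \<open>w \<in> V\<close> \<open>gdist z w = 0\<close> by metis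
    then show ?thesis
      by (auto simp: walk_between_def length_Suc_conv)
  qed
  with 0 show ?case
    by metis
next
  case (Suc n)
  obtain u' where u': "adj u' u" "gdist z u' = n"
    using gdist_predecessor[of z u n] Suc.prems \<open>z \<in> V\<close> by auto
  obtain v' where v': "adj v' v" "gdist z v' = n"
    using gdist_predecessor[of z v n] Suc.prems \<open>z \<in> V\<close> by auto
  note V = adj_in_V[OF u'(1)] adj_in_V[OF v'(1)]
  show ?case
  proof (cases "u' = v'")
    case True
    then show ?thesis
      using u' v' V Suc.prems adj_sym
      by (intro exI[of _ "[u, u', v]"]) (auto simp: walk_between_def walk_def)
  next
    case False
    then obtain xs where xs: "walk_between u' xs v'" "distinct xs" "3 \<le> length xs"
        "\<forall>w\<in>set xs. gdist z w \<le> n"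
      using Suc.IH[of u' v'] u' v' V by blast
    \<comment> \<open>The path from the induction hypothesis stays in the ball of radius
      \<open>n\<close>, while \<open>u\<close> and \<open>v\<close> lie at distance
      \<open>Suc n\<close>; hence the extended path is still simple.\<close>
    have "u \<notin> set xs" "v \<notin> set xs"
      using xs(4) Suc.prems by force+
    moreover have "walk_between u (u # xs @ [v]) v"
      using xs(1) u' v' V adj_sym[of u]
      by (auto simp: walk_between_def walk_def successively_append_iff successively_Cons)
    moreover have "\<forall>w\<in>set (u # xs @ [v]). gdist z w \<le> Suc n"
      using xs(4) Suc.prems by auto
    ultimately show ?thesis
      using xs Suc.prems by (intro exI[of _ "u # xs @ [v]"]) auto
  qed
qed

lemma gdist_adj_neq:
  assumes "z \<in> V" "adj x y"
  shows "gdist z x \<noteq> gdist z y"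
proof
  assume "gdist z x = gdist z y"
  then obtain xs where "walk_between x xs y" "distinct xs" "3 \<le> length xs"
    using path_in_ball[of z x y] adj_in_V[OF assms(2)] adj_neq[OF assms(2)] assms(1) by auto
  then have "cycle xs"
    using assms(2) adj_sym[of x] by (simp add: cycle_def walk_between_def)
  with acyclic show False
    by blast
qed

lemma gdist_adj_cases:
  assumes "z \<in> V" "adj x y"
  shows "gdist z y = Suc (gdist z x) \<or> gdist z x = Suc (gdist z y)"
  using gdist_adj_le[OF assms] gdist_adj_le[of z y x] gdist_adj_neq[OF assms] assms adj_sym[of x]
  by auto

text \<open>Every uniqueness claim below rests on this: the first step from \<open>x\<close> towards
  \<open>z\<close> is forced.\<close>

lemma closer_neighbour_unique:
  assumes "z \<in> V" "adj x u" "adj x v" "gdist z u < gdist z x" "gdist z v < gdist z x"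
  shows "u = v"
proof (rule ccontr)
  assume "u \<noteq> v"
  have x: "gdist z x = Suc (gdist z u)" "gdist z x = Suc (gdist z v)"
    using gdist_adj_cases[of z x] assms by fastforce+
  then obtain xs where xs: "walk_between u xs v" "distinct xs" "3 \<le> length xs"
      "\<forall>w\<in>set xs. gdist z w \<le> gdist z u"
    using path_in_ball[of z u v] \<open>u \<noteq> v\<close> adj_in_V[OF assms(2)] adj_in_V[OF assms(3)] assms(1)
    by auto
  \<comment> \<open>\<open>x\<close> lies one step outside the ball that contains the path, so
    joining both ends to \<open>x\<close> gives a simple cycle.\<close>
  have "x \<notin> set xs"
    using xs(4) x by fastforce
  then have "cycle (x # xs)"
    using xs assms(2,3) adj_sym[of x v] adj_in_V[OF assms(2)]
    by (auto simp: cycle_def walk_between_def walk_def successively_Cons)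
  with acyclic show False
    by blast
qed

end

section \<open>Levels and fathers\<close>

context tree_rooted_at_infinity
begin

lemma ray_adj: "adj (\<gamma> i) (\<gamma> (Suc i))"
  using ray_geodesic[of i "Suc i"] ray_in_V by (intro gdist_1_adj) auto

text \<open>The first step away from a closest point cannot decrease the distance to
  \<open>x\<close>. Once the distance has grown, a later decrease would give a ray vertex two
  neighbours closer to \<open>x\<close>.\<close>

lemma ray_gdist_from_projection:
  assumes "x \<in> V" and min: "\<And>i. gdist (\<gamma> j) x \<le> gdist (\<gamma> i) x"
  shows "gdist (\<gamma> (j + n)) x = gdist (\<gamma> j) x + n"
proof -
  have "gdist x (\<gamma> (Suc (j + n))) = Suc (gdist x (\<gamma> (j + n)))" for n
  proof (induction n)
    case 0
    then show ?case
      using gdist_adj_cases[OF \<open>x \<in> V\<close> ray_adj[of j]] min[of "Suc j"]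
      by (auto simp: gdist_commute)
  next
    case (Suc n)
    let ?i = "j + n"
    \<comment> \<open>The ray does not backtrack, so these two neighbours of
      \<open>\<gamma> (Suc ?i)\<close> are distinct.\<close>
    have "gdist (\<gamma> ?i) (\<gamma> (Suc (Suc ?i))) = 2"
      using ray_geodesic[of ?i "Suc (Suc ?i)"] by simp
    then have "\<gamma> ?i \<noteq> \<gamma> (Suc (Suc ?i))"
      using gdist_self[OF ray_in_V] by (metis zero_neq_numeral)
    then have "\<not> gdist x (\<gamma> (Suc (Suc ?i))) < gdist x (\<gamma> (Suc ?i))"
      using closer_neighbour_unique[OF \<open>x \<in> V\<close>, of "\<gamma> (Suc ?i)" "\<gamma> ?i" "\<gamma> (Suc (Suc ?i))"]
        ray_adj[of ?i] ray_adj[of "Suc ?i"] Suc.IH adj_sym by auto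
    then show ?case
      using gdist_adj_cases[OF \<open>x \<in> V\<close> ray_adj[of "Suc ?i"]] by auto
  qed
  then have "gdist x (\<gamma> (j + n)) = gdist x (\<gamma> j) + n"
    by (induction n) auto
  then show ?thesis
    by (simp add: gdist_commute)
qed

text \<open>The distance grows strictly along the ray after a minimiser, so there is only one
  minimiser and the definite description in \<open>proj\<close> is meaningful.\<close>

lemma proj_eqI:
  assumes "x \<in> V" and min: "\<And>i. gdist (\<gamma> j) x \<le> gdist (\<gamma> i) x"
  shows "proj x = \<gamma> j"
  unfolding proj_def
proof (rule the_equality)
  show "is_arg_min (\<lambda>q. gdist q x) (\<lambda>q. q \<in> range \<gamma>) (\<gamma> j)"
    using min by (auto simp: is_arg_min_linorder)
next
  fix p
  assume "is_arg_min (\<lambda>q. gdist q x) (\<lambda>q. q \<in> range \<gamma>) p"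
  then obtain i where p: "p = \<gamma> i" and min': "\<And>k. gdist (\<gamma> i) x \<le> gdist (\<gamma> k) x"
    by (auto simp: is_arg_min_linorder)
  have "gdist (\<gamma> i) x = gdist (\<gamma> j) x"
    using min min' by (intro antisym)
  \<comment> \<open>Start from whichever minimiser comes first on the ray; the equal distances force
    the growth up to the other one to be zero.\<close>
  then have "i = j"
    using ray_gdist_from_projection[OF \<open>x \<in> V\<close> min, of "i - j"]
      ray_gdist_from_projection[OF \<open>x \<in> V\<close> min', of "j - i"]
    by (cases "i \<le> j") auto
  then show "p = \<gamma> j"
    using p by simp
qed

text \<open>Beyond the projection \<open>\<gamma> j\<close> of \<open>x\<close>, the distance from
  \<open>\<gamma> n\<close> is \<open>n - j\<close> plus the distance from
  \<open>\<gamma> j\<close>. Levels of several vertices can thus be compared through distances from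
  a single \<open>\<gamma> n\<close>.\<close>

lemma level_busemann:
  assumes "x \<in> V"
  shows "\<forall>\<^sub>F n in sequentially. int (gdist (\<gamma> n) x) = int n - level x"
proof -
  obtain j where min: "\<And>i. gdist (\<gamma> j) x \<le> gdist (\<gamma> i) x"
    using ex_has_least_nat[of "\<lambda>_. True" 0 "\<lambda>i. gdist (\<gamma> i) x"] by auto
  have "gdist orig (\<gamma> j) = j"
    using ray_geodesic[of 0 j] ray_start by simp
  then have level: "level x = int j - int (gdist (\<gamma> j) x)"
    by (simp add: level_def proj_eqI[OF assms min])
  have "int (gdist (\<gamma> n) x) = int n - level x" if "j \<le> n" for n
    using ray_gdist_from_projection[OF assms min, of "n - j"] that level by simp
  then show ?thesis
    by (auto simp: eventually_sequentially)
qed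

lemma level_adj:
  assumes "adj x y"
  shows "level y = level x - 1 \<or> level y = level x + 1"
proof -
  have "\<forall>\<^sub>F n in sequentially. int (gdist (\<gamma> n) x) = int n - level x \<and>
      int (gdist (\<gamma> n) y) = int n - level y"
    using adj_in_V[OF assms] by (intro eventually_conj level_busemann)
  then obtain n where "int (gdist (\<gamma> n) x) = int n - level x"
      "int (gdist (\<gamma> n) y) = int n - level y"
    using eventually_happens'[OF sequentially_bot] by blast
  then show ?thesis
    using gdist_adj_cases[OF ray_in_V[of n] assms] by auto
qed

text \<open>Seen from a common \<open>\<gamma> n\<close> far out, both \<open>u\<close> and
  \<open>v\<close> are neighbours of \<open>x\<close> closer to \<open>\<gamma> n\<close>.\<close>

lemma father_unique:
  assumes "adj x u" "adj x v" "level u = level x + 1" "level v = level x + 1"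
  shows "u = v"
proof -
  have "\<forall>\<^sub>F n in sequentially. int (gdist (\<gamma> n) x) = int n - level x \<and>
      int (gdist (\<gamma> n) u) = int n - level u \<and> int (gdist (\<gamma> n) v) = int n - level v"
    using adj_in_V[OF assms(1)] adj_in_V[OF assms(2)] by (intro eventually_conj level_busemann)
  then obtain n where "int (gdist (\<gamma> n) x) = int n - level x"
      "int (gdist (\<gamma> n) u) = int n - level u" "int (gdist (\<gamma> n) v) = int n - level v"
    using eventually_happens'[OF sequentially_bot] by blast
  then show ?thesis
    using closer_neighbour_unique[OF ray_in_V[of n] assms(1,2)] assms(3,4) by auto
qed

lemma sons_disjoint:
  assumes "y \<in> sons u" "y \<in> sons v"
  shows "u = v"
proof (rule father_unique)
  show "adj y u" "adj y v"
    using assms adj_sym by (simp_all add: sons_def)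
  show "level u = level y + 1" "level v = level y + 1"
    using assms unfolding sons_def by simp_all
qed

section \<open>Generations of descendants\<close>

primrec generation :: "'v \<Rightarrow> nat \<Rightarrow> 'v set" where
  "generation x 0 = {x}"
| "generation x (Suc k) = (\<Union>y\<in>generation x k. sons y)"

lemma generation_subset: "x \<in> V \<Longrightarrow> generation x k \<subseteq> V"
  by (cases k) (auto simp: sons_def)

lemma level_generation: "y \<in> generation x k \<Longrightarrow> level y = level x - int k"
  by (induction k arbitrary: y) (auto simp: sons_def)

lemma gdist_generation:
  assumes "z \<in> V" "y \<in> generation x k"
  shows "gdist z y \<le> gdist z x + k"
  using assms(2)
proof (induction k arbitrary: y)
  case (Suc k)
  then obtain w where "w \<in> generation x k" "adj w y"
    by (auto simp: sons_def)
  then show ?case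
    using Suc.IH[of w] gdist_adj_le[OF assms(1), of w y] by simp
qed simp

text \<open>Any two of these vertices are joined through \<open>x\<close>, by at most
  \<open>n\<close> steps on each side.\<close>

lemma generations_bounded:
  assumes "x \<in> V"
  shows "gbounded (\<Union>k\<le>n. generation x k)"
  unfolding gbounded_def
proof (intro exI ballI)
  fix y z
  assume "y \<in> (\<Union>k\<le>n. generation x k)" "z \<in> (\<Union>k\<le>n. generation x k)"
  then obtain k l where y: "y \<in> generation x k" "k \<le> n" and z: "z \<in> generation x l" "l \<le> n"
    by auto
  have "gdist y z \<le> gdist x y + l"
    using gdist_generation[of y z x l] z generation_subset[OF assms] y gdist_commute[of x y] by auto
  also have "\<dots> \<le> k + l"
    using gdist_generation[OF assms y(1)] gdist_self[OF assms] by simp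
  finally show "gdist y z \<le> 2 * n"
    using y z by simp
qed

text \<open>A vertex strictly between the first and last generation has all its neighbours inside:
  its sons in the next generation and its father in the previous one.\<close>

lemma boundary_generations:
  "boundary (\<Union>k\<le>n. generation x k) \<subseteq> insert x (generation x n)"
proof
  fix y
  assume "y \<in> boundary (\<Union>k\<le>n. generation x k)"
  then obtain k w where k: "k \<le> n" "y \<in> generation x k"
    and w: "w \<in> V" "adj y w" and w_out: "\<And>k. k \<le> n \<Longrightarrow> w \<notin> generation x k"
    by (auto simp: boundary_def)
  show "y \<in> insert x (generation x n)"
  proof (rule ccontr)
    assume y: "y \<notin> insert x (generation x n)"
    then have "k \<noteq> 0" "k < n"
      using k by (auto simp: le_less intro: Nat.gr0I)
    then obtain l where l: "k = Suc l"
      by (cases k) auto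
    then obtain v where v: "v \<in> generation x l" "y \<in> sons v"
      using k by auto
    consider "level w = level y - 1" | "level w = level y + 1"
      using level_adj[OF w(2)] by blast
    then show False
    proof cases
      case 1
      then have "w \<in> generation x (Suc k)"
        using w k by (auto simp: sons_def)
      then show False
        using w_out[of "Suc k"] \<open>k < n\<close> by auto
    next
      case 2
      have "adj y v"
        using v(2) adj_sym by (simp add: sons_def)
      moreover have "level v = level y + 1"
        using v(2) unfolding sons_def by simp
      ultimately have "w = v"
        using father_unique[OF w(2)] 2 by blast
      then show False
        using v w_out[of l] l \<open>k < n\<close> by auto
    qed
  qed
qed

section \<open>Masses of generations and of their boundary\<close>

text \<open>Passing to the next generation replaces each \<open>m y\<close> by the sum over the sons
  of \<open>y\<close>. The double sum is taken over pairs of a father and a son, which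
  \<open>snd\<close> maps injectively since no vertex has two fathers.\<close>

lemma generation_has_sum:
  assumes "flow_measure m" "x \<in> V"
  shows "(m has_sum m x) (generation x k)"
proof (induction k)
  case 0
  then show ?case
    using has_sum_finite[of "{x}" m] by simp
next
  case (Suc k)
  let ?S = "Sigma (generation x k) sons"
  have sub: "generation x k \<subseteq> V"
    using generation_subset assms by blast
  have sons: "((\<lambda>z. m (snd (y, z))) has_sum m y) (sons y)" if "y \<in> generation x k" for y
    using that sub assms(1) by (auto simp: flow_measure_def)
  \<comment> \<open>Joint summability follows from that of the iterated sums because
    \<open>m\<close> is nonnegative.\<close>
  have "(\<lambda>p. m (snd p)) summable_on ?S"
    using Suc.IH assms(1)
    by (intro summable_on_SigmaI[OF sons])
       (auto simp: summable_on_def flow_measure_def sons_def less_imp_le)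
  then have "((\<lambda>p. m (snd p)) has_sum m x) ?S"
    using sons Suc.IH by (intro has_sum_SigmaI[where f = "\<lambda>p. m (snd p)" and g = m]) auto
  moreover have "inj_on snd ?S"
    using sons_disjoint by (auto simp: inj_on_def)
  moreover have "snd ` ?S = generation x (Suc k)"
    by force
  ultimately show ?case
    using has_sum_reindex[of snd ?S m "m x"] by (simp add: o_def)
qed

lemma generations_has_sum:
  assumes "flow_measure m" "x \<in> V"
  shows "(m has_sum real (Suc n) * m x) (\<Union>k\<le>n. generation x k)"
proof (induction n)
  case 0
  then show ?case
    using generation_has_sum[OF assms, of 0] by simp
next
  case (Suc n)
  \<comment> \<open>Different generations lie on different levels.\<close>
  have "(\<Union>k\<le>n. generation x k) \<inter> generation x (Suc n) = {}"
    by (force dest: level_generation simp del: generation.simps)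
  from has_sum_Un_disjoint[OF Suc.IH generation_has_sum[OF assms] this]
  show ?case
    by (simp add: atMost_Suc Un_commute algebra_simps del: generation.simps)
qed

lemma mass_boundary_generations:
  assumes "flow_measure m" "x \<in> V"
  shows "mass m (boundary (\<Union>k\<le>n. generation x k)) \<le> ennreal (2 * m x)"
proof -
  have pos: "\<And>y. y \<in> V \<Longrightarrow> 0 \<le> m y"
    using assms(1) by (auto simp: flow_measure_def less_imp_le)
  have mass: "mass m (generation x k) = ennreal (m x)" for k
    using generation_has_sum[OF assms] generation_subset[OF assms(2)] pos
    by (intro mass_has_sum) auto
  have "boundary (\<Union>k\<le>n. generation x k) \<subseteq> generation x 0 \<union> generation x n"
    using boundary_generations[of x n] by simp
  then have "mass m (boundary (\<Union>k\<le>n. generation x k))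
      \<le> mass m (generation x 0) + mass m (generation x n)"
    using mass_mono mass_Un_le order_trans by metis
  also have "\<dots> = ennreal (2 * m x)"
    unfolding mass using pos[OF assms(2)] by (simp flip: ennreal_plus)
  finally show ?thesis .
qed

theorem flow_measure_not_isoperimetric:
  assumes "flow_measure m"
  shows "\<not> isoperimetric m"
proof
  assume "isoperimetric m"
  then obtain C where C: "C > 0" and
    iso: "\<And>A. A \<subseteq> V \<Longrightarrow> gbounded A \<Longrightarrow> ennreal C * mass m A \<le> mass m (boundary A)"
    by (auto simp: isoperimetric_def)
  have orig: "orig \<in> V"
    using ray_in_V[of 0] ray_start by simp
  then have pos: "0 < m orig" "\<And>y. y \<in> V \<Longrightarrow> 0 \<le> m y"
    using assms by (auto simp: flow_measure_def less_imp_le)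
  \<comment> \<open>The inequality for generations \<open>0\<close> to \<open>n\<close> would give
    \<open>C * (n + 1) \<le> 2\<close>, which fails for this \<open>n\<close>.\<close>
  obtain n where n: "2 / C < real n"
    using reals_Archimedean2 by blast
  let ?A = "\<Union>k\<le>n. generation orig k"
  have A: "?A \<subseteq> V"
    using generation_subset[OF orig] by blast
  have "ennreal (C * (real (Suc n) * m orig)) = ennreal C * mass m ?A"
    using A pos C
    by (subst mass_has_sum[OF generations_has_sum[OF assms orig]])
       (auto simp: ennreal_mult simp del: of_nat_Suc)
  also have "\<dots> \<le> ennreal (2 * m orig)"
    using iso[OF A generations_bounded[OF orig]] mass_boundary_generations[OF assms orig]
    by (rule order_trans)
  \<comment> \<open>Both sides are finite and nonnegative, so the comparison returns to the reals,
    where \<open>m orig\<close> can be cancelled.\<close>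
  finally have "C * real (Suc n) * m orig \<le> 2 * m orig"
    using pos(1) by (simp add: ennreal_le_iff mult.assoc)
  then have "C * real (Suc n) \<le> 2"
    using pos(1) by simp
  moreover have "2 < C * real n"
    using n C by (simp add: field_simps)
  ultimately show False
    using C by (simp add: algebra_simps)
qed

end

theorem mainTheorem11:
  fixes V :: "'v set" and E :: "'v set set" and orig :: 'v and \<gamma> :: "nat \<Rightarrow> 'v"
    and m :: "'v \<Rightarrow> real"
  assumes "tree_rooted_at_infinity V E orig \<gamma>"
    and "tree_rooted_at_infinity.flow_measure V E orig \<gamma> m"
  shows "\<not> ugraph.isoperimetric V E m"
  using tree_rooted_at_infinity.flow_measure_not_isoperimetric[OF assms] .

end
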